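(* Let $n$ be any positive integer and let $q$ be any prime power. Then $$|\mathcal{R}_n(\mathbb{F}_q)|=q^n\Big(\sum_{abc=n}\mu(a)\,q^{b-1}\gcd(c,q-1)\Big),$$ where the sum is over all ordered triples $(a,b,c)$ of positive integers with $abc=n$.
   Context: For monic degree $n$ polynomials $\phi(z)=z^n+a_{n-1}z^{n-1}+\cdots+a_0$ and $\psi(z)=z^n+b_{n-1}z^{n-1}+\cdots+b_0$, the resultant $\mathcal{R}(\phi,\psi)$ is the determinant of the $2n\times 2n$ matrix whose first $n$ rows are the successive right shifts of $(a_0,a_1,\dots,a_{n-1},1,0,\dots,0)$ and whose last $n$ rows are the successive right shifts of $(b_0,b_1,\dots,b_{n-1},1,0,\dots,0)$ (equal to $\prod_{\psi(\beta)=0}\phi(\beta)$, roots with multiplicity). $\mathcal{R}_n(\mathbb{F}_q)$ is the set of pairs $(\phi,\psi)$ of monic degree $n$ polynomials over $\mathbb{F}_q$ with $\mathcal{R}(\phi,\psi)=1$. (Equivalently, via $A=\psi$, $B=\phi-\psi$: pairs $(A,B)$ with $A$ monic of degree $n$, $\deg B<n$, and $\prod_{A(\alpha)=0}B(\alpha)=1$.) $\mu$ is the Möbius function. *)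

theory Defs
  imports
    "Jordan_Normal_Form.Determinant"
    "HOL-Computational_Algebra.Computational_Algebra"
    "HOL-Number_Theory.Prime_Powers"
begin

(* Coefficients are listed in ascending order, as opposed to the descending
   order customary for Sylvester matrices.  For monic f and g of degree n the
   determinant is therefore the product of f(b) over the roots b of g, with no sign. *)
definition resultant_matrix :: "nat \<Rightarrow> 'a::comm_ring_1 poly \<Rightarrow> 'a poly \<Rightarrow> 'a mat" where
  "resultant_matrix n f g = mat (2 * n) (2 * n) (\<lambda>(i, j).
     if i < n then (if i \<le> j then coeff f (j - i) else 0)
     else (if i - n \<le> j then coeff g (j - (i - n)) else 0))"

definition monic_resultant :: "nat \<Rightarrow> 'a::comm_ring_1 poly \<Rightarrow> 'a poly \<Rightarrow> 'a" where
  "monic_resultant n f g = det (resultant_matrix n f g)"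

definition resultant_one_pairs :: "nat \<Rightarrow> ('a::field poly \<times> 'a poly) set" where
  "resultant_one_pairs n = {(f, g).
     degree f = n \<and> lead_coeff f = 1 \<and> degree g = n \<and> lead_coeff g = 1 \<and>
     monic_resultant n f g = 1}"

definition moebius_mu :: "nat \<Rightarrow> int" where
  "moebius_mu n = (if squarefree n then (- 1) ^ card (prime_factors n) else 0)"

end

theory Submission
  imports Defs "Subresultants.Subresultant" "HOL-Library.Cardinality"
begin

text \<open>
The count runs the Euclidean algorithm backwards. For all nonzero \<open>x\<close> at once, let \<open>N n x\<close> be the
number of pairs \<open>(A, B)\<close> with \<open>A\<close> monic of degree \<open>n\<close>, \<open>B\<close> of degree less than \<open>n\<close> and
\<open>resultant A B = x\<close>; the pairs in question are those with \<open>A = g\<close>, \<open>B = f - g\<close> and \<open>x = 1\<close>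
(\<open>card_resultant_one_pairs\<close>). If \<open>B\<close> has degree \<open>k > 0\<close> and is \<open>b\<close> times the monic polynomial \<open>C\<close>, then
\<open>resultant A B = b ^ n * (- 1) ^ (n * k) * resultant C (A mod C)\<close>, and each remainder modulo \<open>C\<close> belongs
to \<open>q ^ (n - k)\<close> polynomials \<open>A\<close>. Writing \<open>T n x\<close> for the number of \<open>n\<close>-th roots of \<open>x\<close>, this gives
(\<open>resultant_fiber_recurrence\<close>)

\<open>N n x = q ^ n * T n x
  + (\<Sum>0 < k < n. q ^ (n - k) * (\<Sum>b \<noteq> 0. N k (x * (- 1) ^ (n * k) / b ^ n)))\<close>.

The inner sum is a convolution with \<open>T n\<close> on the group of units, so it is diagonalized by the
characters of that group. It is enough to group the characters by their order: let \<open>E m\<close> be the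
sum of all characters of order exactly \<open>m\<close>, obtained from \<open>T\<close> by Moebius inversion. The sum over
\<open>b\<close> multiplies \<open>E m\<close> by \<open>q - 1\<close> if \<open>m\<close> divides \<open>n\<close> and kills it otherwise
(\<open>primitive_character_sum_twisted_sum\<close>), and then the sign is an \<open>m\<close>-th power, which \<open>E m\<close> does not see. So
each \<open>m\<close> dividing \<open>n\<close> has its own scalar recurrence, with a geometric sum as its solution
(\<open>card_resultant_fiber\<close>):

\<open>N n x = (\<Sum>m | m dvd n. q ^ (n + n div m - 1) * E m x)\<close>.

At \<open>x = 1\<close> the number of \<open>d\<close>-th roots is \<open>gcd d (q - 1)\<close> (\<open>card_roots_of_unity\<close>). Expanding \<open>E m 1\<close> as a
Moebius sum turns the right-hand side into the sum over triples.
\<close>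

section \<open>Resultants\<close>

text \<open>Reversing the order of the rows and of the columns applies the same permutation twice, so the
two signs cancel.\<close>

lemma det_rotate:
  fixes A :: "'a::comm_ring_1 mat"
  assumes A: "A \<in> carrier_mat n n"
  shows "det (mat n n (\<lambda>(i, j). A $$ (n - 1 - i, n - 1 - j))) = det A"
proof -
  define p where "p = (\<lambda>i. if i < n then n - 1 - i else i)"
  have p: "p permutes {0..<n}"
  proof (rule bij_imp_permutes)
    show "bij_betw p {0..<n} {0..<n}"
      by (rule bij_betwI[of _ _ _ p]) (auto simp: p_def)
  qed (auto simp: p_def)
  define B where "B = mat n n (\<lambda>(i, j). A $$ (p i, j))"
  have B: "B \<in> carrier_mat n n" by (simp add: B_def)
  have "transpose_mat (mat n n (\<lambda>(i, j). A $$ (n - 1 - i, n - 1 - j)))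
      = mat n n (\<lambda>(i, j). transpose_mat B $$ (p i, j))"
    by (rule eq_matI) (auto simp: B_def p_def)
  then have "det (transpose_mat (mat n n (\<lambda>(i, j). A $$ (n - 1 - i, n - 1 - j))))
      = signof p * det (transpose_mat B)"
    using det_permute_rows[OF _ p, of "transpose_mat B"] B by simp
  also have "det (transpose_mat B) = signof p * det A"
    using det_permute_rows[OF A p] det_transpose[OF B] by (simp add: B_def)
  also have "signof p * (signof p * det A) = det A"
    by (simp add: sign_def)
  finally show ?thesis by (subst (asm) det_transpose) auto
qed

text \<open>Rotating the ascending matrix by a half turn makes the coefficients descend and moves the rows of
\<open>g\<close> above those of \<open>f\<close>. This is why the arguments change places without a sign.\<close>

lemma monic_resultant_eq_resultant:
  fixes f g :: "'a::comm_ring_1 poly"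
  assumes "degree f = n" "degree g = n"
  shows "monic_resultant n f g = resultant g f"
proof -
  have "resultant_matrix n f g
      = mat (n + n) (n + n) (\<lambda>(i, j). sylvester_mat g f $$ (n + n - 1 - i, n + n - 1 - j))"
  proof (rule eq_matI)
    fix i j
    assume "i < dim_row (mat (n + n) (n + n)
        (\<lambda>(i, j). sylvester_mat g f $$ (n + n - 1 - i, n + n - 1 - j)))"
      and "j < dim_col (mat (n + n) (n + n)
        (\<lambda>(i, j). sylvester_mat g f $$ (n + n - 1 - i, n + n - 1 - j)))"
    then have ij: "i < n + n" "j < n + n" by auto
    then have ij': "n + n - 1 - i < degree g + degree f" "n + n - 1 - j < degree g + degree f"
      using assms by auto
    have "sylvester_mat g f $$ (n + n - 1 - i, n + n - 1 - j) = resultant_matrix n f g $$ (i, j)"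
    proof (cases "i < n")
      case True
      then show ?thesis
        using ij coeff_eq_0[of f "j - i"] assms
        by (subst sylvester_index_mat[OF ij']) (auto simp: resultant_matrix_def)
    next
      case False
      define i' where "i' = i - n"
      have i': "i = n + i'" "i' < n" using False ij by (auto simp: i'_def)
      have "n + (n + n - 1 - i) - (n + n - 1 - j) = j - i'" if "i' \<le> j"
        using that ij i' by auto
      then show ?thesis
        using ij coeff_eq_0[of g "j - i'"] assms i'
        by (subst sylvester_index_mat[OF ij']) (auto simp: resultant_matrix_def)
    qed
    then show "resultant_matrix n f g $$ (i, j) = mat (n + n) (n + n)
        (\<lambda>(i, j). sylvester_mat g f $$ (n + n - 1 - i, n + n - 1 - j)) $$ (i, j)"
      using ij by simp
  qed (auto simp: resultant_matrix_def)
  then show ?thesis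
    unfolding monic_resultant_def resultant_def
    using det_rotate[of "sylvester_mat g f" "n + n"] sylvester_carrier_mat[of g f] assms by simp
qed

text \<open>The roots of \<open>G\<close> only see \<open>F\<close> modulo \<open>G\<close>. This one division step of the Euclidean algorithm is
the case \<open>J = 0\<close> of the Brown--Traub formulas for subresultants. There, a constant remainder
obeys a different formula from one of positive degree, and the two are unified here.\<close>

lemma resultant_monic_reduce:
  fixes F G H :: "'a::idom poly"
  assumes "lead_coeff G = 1" and "degree H < degree G" and "degree G \<le> degree F"
    and eq: "F = B * G + H"
  shows "resultant G F = resultant G H"
proof -
  have FGH: "F + (- B) * G = H" using eq by simp
  have ch: "degree G > degree H \<or> H = 0 \<and> F \<noteq> 0 \<and> G \<noteq> 0" using assms by simp
  have sub: "subresultant 0 F G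
      = smult ((-1) ^ (degree F * degree G)) [:resultant G H:]"
  proof (cases "degree H = 0")
    case False
    then show ?thesis
      using BT_lemma_1_12[OF FGH assms(3) ch, of 0] assms by (simp add: subresultant_resultant)
  next
    case True
    then obtain c where c: "H = [:c:]" by (metis degree_eq_zeroE)
    have "c ^ (degree G - 1) * c = c ^ degree G"
      using assms(2) by (metis True power_minus_mult)
    then show ?thesis
      using BT_lemma_1_13'[OF FGH assms(3) ch, of 0] assms True by (simp add: c mult.assoc)
  qed
  then have "resultant F G = (-1) ^ (degree F * degree G) * resultant G H"
    by (simp add: subresultant_resultant)
  then show ?thesis
    by (simp add: resultant_swap[of G F] mult.commute[of "degree G"])
qed

section \<open>Moebius inversion\<close>

lemma prime_factors_prod_primes:
  assumes "finite S" "\<And>p. p \<in> S \<Longrightarrow> prime (p::nat)"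
  shows "prime_factors (\<Prod>S) = S"
proof -
  have "0 \<notin> S" using assms(2) not_prime_0 by blast
  have "prime_factors (prod (\<lambda>p. p) S) = \<Union>((prime_factors \<circ> (\<lambda>p. p)) ` S)"
    using assms(1) \<open>0 \<notin> S\<close> by (intro prime_factors_prod) auto
  also have "\<dots> = S"
    using assms(2) by (auto simp: prime_prime_factors)
  finally show ?thesis by simp
qed

text \<open>Squarefree divisors correspond to sets of prime factors, and the alternating sum over all subsets
is the expansion of a product of zeros, which is empty only for \<open>n = 1\<close>.\<close>

lemma sum_moebius_mu_divisors:
  assumes "n > 0"
  shows "(\<Sum>d | d dvd n. moebius_mu d) = (if n = 1 then 1 else 0)"
proof -
  let ?P = "prime_factors n"
  have "(\<Sum>d | d dvd n. moebius_mu d) = (\<Sum>d | d dvd n \<and> squarefree d. (- 1) ^ card (prime_factors d))"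
    using assms by (intro sum.mono_neutral_cong_right) (auto simp: moebius_mu_def)
  also have "\<dots> = (\<Sum>S\<in>Pow ?P. (- 1) ^ card S)"
  proof (rule sum.reindex_bij_witness[of _ Prod prime_factors], goal_cases)
    case (1 d)
    then have "d \<noteq> 0" using assms by (auto intro: Nat.gr0I)
    with 1 have "d = (\<Prod>p\<in>prime_factors d. p ^ multiplicity p d)"
      by (simp add: prod_prime_factors)
    also have "\<dots> = \<Prod>(prime_factors d)"
      using 1 \<open>d \<noteq> 0\<close> by (intro prod.cong) (auto simp: squarefree_factorial_semiring')
    finally show ?case by simp
  next
    case (2 d)
    then show ?case using assms by (auto dest: dvd_prime_factors[rotated])
  next
    case (3 S)
    then show ?case by (intro prime_factors_prod_primes) (auto intro: finite_subset)
  next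
    case (4 S)
    then have S: "finite S" "\<And>p. p \<in> S \<Longrightarrow> prime p" "S \<subseteq> ?P" by (auto intro: finite_subset)
    have "\<Prod>S dvd \<Prod>?P" using S by (intro prod_dvd_prod_subset) auto
    also have "\<Prod>?P dvd (\<Prod>p\<in>?P. p ^ multiplicity p n)"
      using assms by (intro prod_dvd_prod dvd_power) (auto simp: prime_factors_multiplicity)
    also have "\<dots> = n" using assms by (simp add: prod_prime_factors)
    finally have "\<Prod>S dvd n" .
    moreover have "squarefree (\<Prod>p\<in>S. p)"
      using S by (intro squarefree_prod_coprime) (auto simp: primes_coprime squarefree_prime)
    ultimately show ?case by simp
  next
    case (5 d)
    then show ?case by simp
  qed
  also have "\<dots> = (\<Prod>p\<in>?P. (-1) + 1 :: int)"
    by (subst prod_add) simp_all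
  also have "\<dots> = (if ?P = {} then 1 else 0)" by (simp add: card_gt_0_iff)
  also have "?P = {} \<longleftrightarrow> n = 1" using assms by (auto simp: prime_factorization_empty_iff)
  finally show ?thesis .
qed

lemma moebius_inversion:
  fixes f :: "nat \<Rightarrow> int"
  assumes "n > 0"
  shows "(\<Sum>m | m dvd n. \<Sum>d | d dvd m. moebius_mu (m div d) * f d) = f n"
proof -
  have pos: "m > 0" if "m dvd n" for m using that assms by (auto intro: Nat.gr0I)
  have "(\<Sum>m | m dvd n. \<Sum>d | d dvd m. moebius_mu (m div d) * f d)
      = (\<Sum>(m, d) \<in> (SIGMA m:{m. m dvd n}. {d. d dvd m}). moebius_mu (m div d) * f d)"
    using assms pos by (subst sum.Sigma) auto
  also have "\<dots> = (\<Sum>(d, e) \<in> (SIGMA d:{d. d dvd n}. {e. e dvd n div d}). moebius_mu e * f d)"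
    using pos
    by (intro sum.reindex_bij_witness[of _ "\<lambda>(d, e). (d * e, d)" "\<lambda>(m, d). (d, m div d)"])
       (auto simp: div_dvd_div intro: dvd_trans elim!: dvdE)
  also have "\<dots> = (\<Sum>d | d dvd n. \<Sum>e | e dvd n div d. moebius_mu e * f d)"
    using assms pos by (subst sum.Sigma) (auto simp: dvd_div_eq_0_iff)
  also have "\<dots> = (\<Sum>d | d dvd n. if d = n then f n else 0)"
  proof (intro sum.cong refl)
    fix d assume "d \<in> {d. d dvd n}"
    then have d: "d dvd n" by simp
    then have "n div d > 0" using assms pos by (simp add: div_greater_zero_iff dvd_imp_le)
    moreover have "n div d = 1 \<longleftrightarrow> d = n" using d assms by auto
    ultimately show "(\<Sum>e | e dvd n div d. moebius_mu e * f d) = (if d = n then f n else 0)"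
      by (simp add: sum_distrib_right[symmetric] sum_moebius_mu_divisors)
  qed
  also have "\<dots> = f n" using assms by simp
  finally show ?thesis .
qed

section \<open>Roots of unity in finite fields\<close>

lemma finite_field_power_card_minus_one:
  fixes a :: "'a::{field, finite}"
  assumes "a \<noteq> 0"
  shows "a ^ (CARD('a) - 1) = 1"
proof -
  have "(\<Prod>y\<in>- {0}. y) = (\<Prod>y\<in>- {0}. a * y)"
    using assms
    by (intro prod.reindex_bij_witness[of _ "\<lambda>y. a * y" "\<lambda>y. y / a"]) auto
  also have "\<dots> = a ^ card (- {0::'a}) * (\<Prod>y\<in>- {0}. y)"
    by (simp add: prod.distrib)
  also have "card (- {0::'a}) = CARD('a) - 1"
    by (simp add: Compl_eq_Diff_UNIV)
  finally show ?thesis by simp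
qed

text \<open>The polynomial \<open>y ^ (q - 1) - 1\<close> vanishes at every unit and splits off the factor \<open>y ^ e - 1\<close>. The
cofactor \<open>H\<close> has too few roots to leave fewer than \<open>e\<close> of them for \<open>y ^ e - 1\<close>.\<close>

lemma card_roots_of_unity_dvd:
  assumes e: "e dvd CARD('a) - 1"
  shows "card {y::'a::{field, finite}. y ^ e = 1} = e"
proof -
  let ?N = "CARD('a) - 1"
  have N: "?N > 0"
    using card_mono[of UNIV "{0, 1::'a}"] by simp
  obtain k where k: "?N = e * k" using e by auto
  have ek: "e > 0" "k > 0" using N k by (auto intro: Nat.gr0I)
  define H where "H = (\<Sum>i<k. monom (1::'a) (e * i))"
  have polyH: "poly H y = (\<Sum>i<k. (y ^ e) ^ i)" for y
    by (simp add: H_def poly_sum poly_monom power_mult)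
  have "poly H 0 = (\<Sum>i<k. if i = 0 then 1 else 0)"
    unfolding polyH using ek by (intro sum.cong) auto
  then have "poly H 0 = 1" using ek by simp
  then have H0: "H \<noteq> 0" by auto
  have degH: "degree H \<le> e * k - e"
    unfolding H_def
  proof (rule degree_sum_le, goal_cases)
    case (2 i)
    then have "e * i \<le> e * (k - 1)" by (intro mult_le_mono2) auto
    then show ?case by (simp add: degree_monom_eq diff_mult_distrib2)
  qed simp
  have "y ^ e = 1 \<or> poly H y = 0" if "y \<noteq> 0" for y
  proof -
    have "(y ^ e - 1) * poly H y = (y ^ e) ^ k - 1"
      by (simp add: polyH power_diff_1_eq)
    also have "\<dots> = 0"
      using finite_field_power_card_minus_one[OF that] k by (simp flip: power_mult)
    finally show ?thesis by simp
  qed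
  then have "- {0::'a} \<subseteq> {y. y ^ e = 1} \<union> {y. poly H y = 0}" by auto
  then have "card (- {0::'a}) \<le> card ({y::'a. y ^ e = 1} \<union> {y. poly H y = 0})"
    by (intro card_mono) auto
  also have "\<dots> \<le> card {y::'a. y ^ e = 1} + card {y. poly H y = 0}"
    by (rule card_Un_le)
  also have "card {y. poly H y = 0} \<le> e * k - e"
    using card_poly_roots_bound[OF H0] degH by simp
  finally have "e * k \<le> card {y::'a. y ^ e = 1} + (e * k - e)"
    using k by (simp add: Compl_eq_Diff_UNIV)
  moreover have "e \<le> e * k" using ek by simp
  ultimately have "e \<le> card {y::'a. y ^ e = 1}" by linarith
  moreover have "card {y::'a. y ^ e = 1} \<le> e"
  proof -
    have nz: "monom 1 e - 1 \<noteq> (0 :: 'a poly)"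
    proof
      assume "monom 1 e - 1 = (0 :: 'a poly)"
      then have "poly (monom 1 e - 1) 0 = (0::'a)" by simp
      then show False using ek by (simp add: poly_monom power_0_left)
    qed
    have "card {y. poly (monom 1 e - 1 :: 'a poly) y = 0} \<le> degree (monom 1 e - 1 :: 'a poly)"
      by (rule card_poly_roots_bound[OF nz])
    also have "\<dots> \<le> e" by (rule degree_diff_le) (auto simp: degree_monom_le)
    finally show ?thesis by (simp add: poly_monom)
  qed
  ultimately show ?thesis by simp
qed

lemma card_roots_of_unity:
  assumes "d > 0"
  shows "card {y::'a::{field, finite}. y ^ d = 1} = gcd d (CARD('a) - 1)"
proof -
  let ?e = "gcd d (CARD('a) - 1)"
  have "y ^ d = 1 \<longleftrightarrow> y ^ ?e = 1" for y :: 'a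
  proof
    assume y: "y ^ d = 1"
    then have "y \<noteq> 0" using assms by (auto simp: power_0_left)
    obtain u v where "d * u = (CARD('a) - 1) * v + ?e"
      using bezout_nat[of d "CARD('a) - 1"] assms by auto
    then have "y ^ (d * u) = y ^ ((CARD('a) - 1) * v + ?e)" by simp
    then show "y ^ ?e = 1"
      using finite_field_power_card_minus_one[OF \<open>y \<noteq> 0\<close>] y
      by (simp add: power_add power_mult)
  next
    assume "y ^ ?e = 1"
    then show "y ^ d = 1"
      by (metis dvdE gcd_dvd1 power_mult power_one)
  qed
  then show ?thesis using card_roots_of_unity_dvd[where ?'a = 'a, of ?e] by simp
qed

section \<open>Character sums as root counts\<close>

text \<open>Monomial maps on pairs of units compose like integer matrices.\<close>

lemma power_int_pair_comp:
  fixes b y :: "'a::field"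
  assumes "b \<noteq> 0" "y \<noteq> 0"
  shows "(b powi p * y powi q) powi r * (b powi p' * y powi q') powi s
    = b powi (p * r + p' * s) * y powi (q * r + q' * s)"
  using assms by (simp add: power_int_mult_distrib power_int_add power_int_mult mult_ac)

definition root_count :: "nat \<Rightarrow> 'a::{field, finite} \<Rightarrow> int" where
  "root_count d x = int (card {y. y ^ d = x})"

lemma root_count_mult_power:
  fixes x s :: "'a::{field, finite}"
  assumes "d dvd m" "s \<noteq> 0"
  shows "root_count d (x * s ^ m) = root_count d x"
proof -
  obtain k where m: "m = d * k" using assms by auto
  have "bij_betw (\<lambda>y. y * s ^ k) {y. y ^ d = x} {y. y ^ d = x * s ^ m}"
    using assms(2)
    by (intro bij_betwI[where g = "\<lambda>y. y / s ^ k"])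
       (auto simp: m power_mult_distrib power_divide power_mult[symmetric] mult.commute)
  then show ?thesis by (simp add: root_count_def bij_betw_same_card)
qed

text \<open>In terms of characters, this says that \<open>\<chi> ^ n = 1\<close> and \<open>\<chi> ^ c = 1\<close> together mean that
\<open>\<chi> ^ gcd n c = 1\<close>. The proof counts the solutions of \<open>b ^ n * y ^ c = x\<close>: a Bezout relation for
\<open>n / g\<close> and \<open>c / g\<close> gives a monomial substitution of determinant one that turns this equation into
\<open>z ^ g = x\<close> with a second, free unit \<open>w\<close>.\<close>

lemma root_count_twisted_sum:
  fixes x :: "'a::{field, finite}"
  assumes n: "n > 0" and c: "c > 0" and x: "x \<noteq> 0"
  shows "(\<Sum>b\<in>- {0}. root_count c (x / b ^ n)) = int (CARD('a) - 1) * root_count (gcd n c) x"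
proof -
  define g where "g = gcd n c"
  obtain n' c' where n': "n = g * n'" and c': "c = g * c'" and cop: "coprime n' c'"
    using gcd_coprime_exists[of n c] n unfolding g_def by (auto simp: mult.commute)
  obtain u v where "u * int n' + v * int c' = gcd (int n') (int c')"
    using bezout_int by blast
  moreover have "gcd (int n') (int c') = 1" using cop by (metis coprime_imp_gcd_eq_1 coprime_int_iff)
  ultimately have uv: "int n' * u + int c' * v = 1" by (simp add: mult.commute)
  have g: "g > 0" using n by (simp add: g_def)
  define L where "L = {(b, y). b \<noteq> 0 \<and> b ^ n * y ^ c = x}"
  define R where "R = {(z, w). z ^ g = x \<and> w \<noteq> (0::'a)}"
  have L_iff: "t \<in> L \<longleftrightarrow> fst t \<noteq> 0 \<and> fst t ^ n * snd t ^ c = x" for t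
    by (cases t) (simp add: L_def)
  have R_iff: "t \<in> R \<longleftrightarrow> fst t ^ g = x \<and> snd t \<noteq> 0" for t
    by (cases t) (simp add: R_def)
  have Lnz: "b \<noteq> 0 \<and> y \<noteq> 0" if "(b, y) \<in> L" for b y
    using that c x by (auto simp: L_def power_0_left)
  have Rnz: "z \<noteq> 0 \<and> w \<noteq> 0" if "(z, w) \<in> R" for z w
    using that g x by (auto simp: R_def power_0_left)
  define F where "F = (\<lambda>(b::'a, y). (b powi int n' * y powi int c', b powi (- v) * y powi u))"
  define G where "G = (\<lambda>(z::'a, w). (z powi u * w powi (- int c'), z powi v * w powi int n'))"
  have FG: "F (G (z, w)) = (z, w)" if "z \<noteq> 0" "w \<noteq> 0" for z w
    unfolding F_def G_def prod.case power_int_pair_comp[OF that]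
    using uv by (simp add: mult.commute add.commute)
  have GF: "G (F (b, y)) = (b, y)" if "b \<noteq> 0" "y \<noteq> 0" for b y
    unfolding F_def G_def prod.case power_int_pair_comp[OF that]
    using uv by (simp add: mult.commute add.commute)
  have pow: "fst (F (b, y)) ^ g = b ^ n * y ^ c" for b y
    by (simp add: F_def n' c' power_mult_distrib power_mult[symmetric] mult.commute)
  have nz: "fst (F (b, y)) \<noteq> 0" "snd (F (b, y)) \<noteq> 0" "fst (G (b, y)) \<noteq> 0" "snd (G (b, y)) \<noteq> 0"
    if "b \<noteq> 0" "y \<noteq> 0" for b y
    using that by (simp_all add: F_def G_def)
  have "bij_betw F L R"
  proof (rule bij_betwI[where g = G])
    show "F \<in> L \<rightarrow> R"
    proof
      fix t assume t: "t \<in> L"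
      then have "fst t \<noteq> 0" "snd t \<noteq> 0" using Lnz[of "fst t" "snd t"] by simp_all
      then have "snd (F t) \<noteq> 0" using nz(2)[of "fst t" "snd t"] by simp
      moreover have "fst (F t) ^ g = x" using pow[of "fst t" "snd t"] t by (simp add: L_iff)
      ultimately show "F t \<in> R" by (simp add: R_iff)
    qed
    show "G \<in> R \<rightarrow> L"
    proof
      fix t assume t: "t \<in> R"
      then have tnz: "fst t \<noteq> 0" "snd t \<noteq> 0" using Rnz[of "fst t" "snd t"] by simp_all
      then have "F (G t) = t" using FG[of "fst t" "snd t"] by simp
      then have "fst (G t) ^ n * snd (G t) ^ c = x"
        using pow[of "fst (G t)" "snd (G t)"] t by (simp add: R_iff)
      moreover have "fst (G t) \<noteq> 0" using nz(3)[of "fst t" "snd t"] tnz by simp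
      ultimately show "G t \<in> L" by (simp add: L_iff)
    qed
    show "G (F t) = t" if "t \<in> L" for t
      using that GF[of "fst t" "snd t"] Lnz[of "fst t" "snd t"] by simp
    show "F (G t) = t" if "t \<in> R" for t
      using that FG[of "fst t" "snd t"] Rnz[of "fst t" "snd t"] by simp
  qed
  then have "card L = card R" by (rule bij_betw_same_card)
  have "R = {z. z ^ g = x} \<times> (- {0})" by (auto simp: R_def)
  then have "int (card R) = int (CARD('a) - 1) * root_count g x"
    by (simp add: root_count_def card_cartesian_product Compl_eq_Diff_UNIV)
  moreover have "L = (SIGMA b:- {0}. {y. y ^ c = x / b ^ n})"
    by (auto simp: L_def field_simps)
  then have "int (card L) = (\<Sum>b\<in>- {0}. root_count c (x / b ^ n))"
    by (simp add: root_count_def)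
  ultimately show ?thesis using \<open>card L = card R\<close> by (simp add: g_def)
qed

text \<open>For \<open>x \<noteq> 0\<close>, \<open>root_count n x\<close> is the sum of \<open>\<chi> x\<close> over the characters \<open>\<chi>\<close> of the unit group with
\<open>\<chi> ^ n = 1\<close>. By Moebius inversion, the following is the sum over the characters of order exactly
\<open>m\<close>, a Ramanujan sum in the discrete logarithm of \<open>x\<close>. The encoding by roots avoids complex
characters.\<close>

definition primitive_character_sum :: "nat \<Rightarrow> 'a::{field, finite} \<Rightarrow> int" where
  "primitive_character_sum m x = (\<Sum>d | d dvd m. moebius_mu (m div d) * root_count d x)"

lemma sum_primitive_character_sum:
  assumes "n > 0"
  shows "(\<Sum>m | m dvd n. primitive_character_sum m x) = root_count n x"
  using moebius_inversion[OF assms, of "\<lambda>d. root_count d x"]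
  by (simp add: primitive_character_sum_def)

text \<open>A character of order \<open>m\<close> is trivial on \<open>m\<close>-th powers.\<close>

lemma primitive_character_sum_mult_power:
  assumes "s \<noteq> 0"
  shows "primitive_character_sum m (x * s ^ m) = primitive_character_sum m x"
  unfolding primitive_character_sum_def
  by (intro sum.cong refl) (simp add: root_count_mult_power assms)

text \<open>This is orthogonality of characters: averaging over \<open>n\<close>-th powers keeps exactly the characters
whose order divides \<open>n\<close>. Summed over the divisors of \<open>m\<close>, both sides agree by
\<open>root_count_twisted_sum\<close>; the terms of the proper divisors are then removed by induction.\<close>

lemma primitive_character_sum_twisted_sum:
  fixes x :: "'a::{field, finite}"
  assumes "n > 0" "m > 0" "x \<noteq> 0"
  shows "(\<Sum>b\<in>- {0}. primitive_character_sum m (x / b ^ n))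
    = (if m dvd n then int (CARD('a) - 1) * primitive_character_sum m x else 0)"
  using assms(2)
proof (induction m rule: less_induct)
  case (less m)
  let ?l = "\<lambda>d. \<Sum>b\<in>- {0}. primitive_character_sum d (x / b ^ n)"
  let ?r = "\<lambda>d. if d dvd n then int (CARD('a) - 1) * primitive_character_sum d x else 0"
  have split: "(\<Sum>d | d dvd m. h d) = h m + (\<Sum>d | d dvd m \<and> d \<noteq> m. h d)" for h :: "nat \<Rightarrow> int"
  proof -
    have "{d. d dvd m} - {m} = {d. d dvd m \<and> d \<noteq> m}" by auto
    then show ?thesis using less.prems sum.remove[of "{d. d dvd m}" m h] by simp
  qed
  have "(\<Sum>d | d dvd m. ?l d) = (\<Sum>b\<in>- {0}. root_count m (x / b ^ n))"
    using less.prems by (subst sum.swap) (simp add: sum_primitive_character_sum)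
  also have "\<dots> = int (CARD('a) - 1) * (\<Sum>d | d dvd gcd n m. primitive_character_sum d x)"
    using assms less.prems by (simp add: root_count_twisted_sum sum_primitive_character_sum[symmetric, of "gcd n m"])
  also have "\<dots> = (\<Sum>d | d dvd m. ?r d)"
    unfolding sum_distrib_left
    using less.prems by (intro sum.mono_neutral_cong_left) auto
  finally have "?l m + (\<Sum>d | d dvd m \<and> d \<noteq> m. ?l d) = ?r m + (\<Sum>d | d dvd m \<and> d \<noteq> m. ?r d)"
    unfolding split .
  moreover have "(\<Sum>d | d dvd m \<and> d \<noteq> m. ?l d) = (\<Sum>d | d dvd m \<and> d \<noteq> m. ?r d)"
  proof (intro sum.cong refl)
    fix d assume "d \<in> {d. d dvd m \<and> d \<noteq> m}"
    then have "d < m" "d > 0"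
      using less.prems dvd_imp_le[of d m] by (auto intro: Nat.gr0I)
    then show "?l d = ?r d" by (rule less.IH)
  qed
  ultimately show ?case by simp
qed

section \<open>Monic polynomials over a finite field\<close>

definition monics :: "nat \<Rightarrow> 'a::field poly set" where
  "monics n = {p. degree p = n \<and> lead_coeff p = 1}"

lemma monicsD: "p \<in> monics n \<Longrightarrow> degree p = n" "p \<in> monics n \<Longrightarrow> coeff p n = 1"
  by (auto simp: monics_def)

lemma monics_Suc: "monics (Suc n) = (\<lambda>(a, p). pCons a p) ` (UNIV \<times> monics n)"
proof (intro equalityI subsetI)
  fix p :: "'a poly" assume p: "p \<in> monics (Suc n)"
  obtain a r where ar: "p = pCons a r" by (cases p)
  then have "r \<noteq> 0" using p by (auto simp: monics_def)
  then have "r \<in> monics n" using p ar by (auto simp: monics_def)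
  then show "p \<in> (\<lambda>(a, p). pCons a p) ` (UNIV \<times> monics n)" using ar by auto
next
  fix p :: "'a poly" assume "p \<in> (\<lambda>(a, p). pCons a p) ` (UNIV \<times> monics n)"
  then show "p \<in> monics (Suc n)" by (auto simp: monics_def)
qed

lemma monics_0: "monics 0 = {1}"
  by (auto simp: monics_def elim!: degree_eq_zeroE)

lemma finite_monics: "finite (monics n :: 'a::{field, finite} poly set)"
  by (induction n) (auto simp: monics_0 monics_Suc)

lemma card_monics: "card (monics n :: 'a::{field, finite} poly set) = CARD('a) ^ n"
proof (induction n)
  case (Suc n)
  have "inj_on (\<lambda>(a::'a, p). pCons a p) (UNIV \<times> monics n)" by (auto simp: inj_on_def)
  then show ?case using Suc by (simp add: monics_Suc card_image card_cartesian_product)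
qed (simp add: monics_0)

lemma monic_add_in_monics:
  assumes "A \<in> monics n" "degree B < n"
  shows "A + B \<in> monics n"
  using assms by (auto simp: monics_def degree_add_eq_left coeff_eq_0)

text \<open>Adding \<open>X ^ n\<close> embeds these polynomials into the monic ones.\<close>

lemma finite_degree_less: "finite {p :: 'a::{field, finite} poly. degree p < n}"
proof (rule finite_imageD)
  show "inj_on (\<lambda>p. monom 1 n + p) {p :: 'a poly. degree p < n}" by (simp add: inj_on_def)
  have "(\<lambda>p. monom 1 n + p) ` {p :: 'a poly. degree p < n} \<subseteq> monics n"
    by (auto intro!: monic_add_in_monics) (simp add: monics_def degree_monom_eq)
  then show "finite ((\<lambda>p. monom 1 n + p) ` {p :: 'a poly. degree p < n})"
    using finite_monics by (rule finite_subset)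
qed

lemma monics_mult:
  assumes "P \<in> monics m" "Q \<in> monics n"
  shows "P * Q \<in> monics (m + n)"
proof -
  have "P \<noteq> 0" "Q \<noteq> 0" using assms by (auto simp: monics_def)
  then show ?thesis using assms by (auto simp: monics_def degree_mult_eq lead_coeff_mult coeff_mult_degree_sum)
qed

lemma div_in_monics:
  assumes A: "A \<in> monics n" and C: "C \<in> monics k" and k: "0 < k" "k \<le> n"
  shows "A div C \<in> monics (n - k)"
proof -
  let ?Q = "A div C" and ?R = "A mod C"
  have C0: "C \<noteq> 0" using C by (auto simp: monics_def)
  have R: "degree ?R < k"
    using degree_mod_less[OF C0, of A] C k by (auto simp: monics_def)
  have eq: "A = ?Q * C + ?R" by simp
  have Q0: "?Q \<noteq> 0"
  proof
    assume "?Q = 0"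
    then have "A = ?R" using eq by simp
    then show False using R A k by (auto simp: monics_def)
  qed
  then have deg: "degree (?Q * C) = degree ?Q + k" using C0 C by (simp add: degree_mult_eq monics_def)
  have "degree A = degree ?Q + k"
    using R deg by (subst eq, subst degree_add_eq_left) auto
  moreover have "lead_coeff (?R + ?Q * C) = lead_coeff ?Q * lead_coeff C"
    unfolding lead_coeff_mult[symmetric] using R deg by (intro lead_coeff_add_le) simp
  then have "lead_coeff A = lead_coeff ?Q * lead_coeff C"
    by simp
  ultimately show ?thesis using A C by (auto simp: monics_def)
qed

section \<open>Counting pairs with a given resultant\<close>

text \<open>The values \<open>x \<noteq> 1\<close> are needed because the recurrence below leads from one value to others.\<close>

definition resultant_fiber :: "nat \<Rightarrow> 'a::field \<Rightarrow> ('a poly \<times> 'a poly) set" where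
  "resultant_fiber n x = {(A, B). A \<in> monics n \<and> degree B < n \<and> resultant A B = x}"

lemma finite_resultant_fiber: "finite (resultant_fiber n x :: ('a::{field, finite} poly \<times> _) set)"
  by (rule finite_subset[of _ "monics n \<times> {p. degree p < n}"])
     (auto simp: resultant_fiber_def finite_monics finite_degree_less)

lemma card_resultant_fiber_degree_0:
  fixes x :: "'a::{field, finite}"
  assumes "n > 0"
  shows "int (card {(A, B) \<in> resultant_fiber n x. degree B = 0}) = int CARD('a) ^ n * root_count n x"
proof -
  have "bij_betw (\<lambda>(A, b). (A, [:b:])) ((monics n :: 'a poly set) \<times> {b. b ^ n = x})
      {(A, B) \<in> resultant_fiber n x. degree B = 0}"
    using assms
    by (intro bij_betwI[where g = "\<lambda>(A, B). (A, coeff B 0)"])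
       (auto simp: resultant_fiber_def monics_def elim!: degree_eq_zeroE)
  then have "card {(A, B) \<in> resultant_fiber n x. degree B = 0} = card ((monics n :: 'a poly set) \<times> {b. b ^ n = x})"
    by (rule bij_betw_same_card[symmetric])
  then show ?thesis by (simp add: card_cartesian_product card_monics root_count_def)
qed

text \<open>Scaling by \<open>b\<close> contributes one factor for each of the \<open>n\<close> roots of \<open>A = Q * C + R\<close>, the exchange of \<open>A\<close>
and \<open>C\<close> contributes the sign, and then \<open>A\<close> may be reduced modulo \<open>C\<close>.\<close>

lemma resultant_euclid_step:
  fixes C :: "'a::field poly"
  assumes Q: "Q \<in> monics (n - k)" and C: "C \<in> monics k" and R: "degree R < k" and k: "k \<le> n"
    and b: "b \<noteq> 0"
  shows "resultant (Q * C + R) (smult b C) = b ^ n * (- 1) ^ (n * k) * resultant C R"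
proof -
  have QC: "Q * C \<in> monics n" using monics_mult[OF Q C] k by simp
  have "degree (Q * C) = n" using QC by (rule monicsD)
  have A: "Q * C + R \<in> monics n" using monic_add_in_monics[OF QC] R k by simp
  have "resultant C (Q * C + R) = resultant C R"
    using R k C monicsD[OF A] by (intro resultant_monic_reduce[of C R _ Q]) (auto simp: monics_def)
  then show ?thesis
    using resultant_swap[of "Q * C + R" C] b monicsD(1)[OF A] monicsD(1)[OF C]
    by (simp add: resultant_smult_right)
qed

text \<open>A pair \<open>(A, B)\<close> is the same as the leading coefficient \<open>b\<close> of \<open>B\<close>, the monic multiple \<open>C\<close> of \<open>B\<close>, and
the quotient and the remainder of \<open>A\<close> by \<open>C\<close>. The quotient is an arbitrary monic polynomial of degree
\<open>n - k\<close>, and \<open>C\<close> with the remainder form a pair of the smaller degree \<open>k\<close>.\<close>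

lemma card_resultant_fiber_degree:
  fixes x :: "'a::{field, finite}"
  assumes k: "0 < k" "k < n"
  shows "int (card {(A, B) \<in> resultant_fiber n x. degree B = k})
    = int CARD('a) ^ (n - k) * (\<Sum>b\<in>- {0}. int (card (resultant_fiber k (x * (- 1) ^ (n * k) / b ^ n))))"
proof -
  define S where "S = (SIGMA b:- {0}. (monics (n - k) :: 'a poly set) \<times> resultant_fiber k (x * (- 1) ^ (n * k) / b ^ n))"
  define F where "F = (\<lambda>(b :: 'a, Q, C, R). (Q * C + R, smult b C))"
  define G where "G = (\<lambda>(A, B :: 'a poly). let b = lead_coeff B; C = smult (inverse b) B
     in (b, A div C, C, A mod C))"
  have "bij_betw F S {(A, B) \<in> resultant_fiber n x. degree B = k}"
  proof (rule bij_betwI[where g = G])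
    show "F \<in> S \<rightarrow> {(A, B) \<in> resultant_fiber n x. degree B = k}"
    proof
      fix t assume "t \<in> S"
      then obtain b Q C R where t: "t = (b, Q, C, R)" and b: "b \<noteq> 0" and Q: "Q \<in> monics (n - k)"
        and C: "C \<in> monics k" and R: "degree R < k"
        and res: "resultant C R = x * (- 1) ^ (n * k) / b ^ n"
        by (auto simp: S_def resultant_fiber_def)
      have "Q * C + R \<in> monics n"
        using monic_add_in_monics[OF monics_mult[OF Q C], of R] R k by simp
      moreover have "resultant (Q * C + R) (smult b C) = x"
        using resultant_euclid_step[OF Q C R _ b] k b by (simp add: res)
      moreover have "degree (smult b C) = k" using b C by (simp add: monics_def)
      ultimately show "F t \<in> {(A, B) \<in> resultant_fiber n x. degree B = k}"
        using k by (simp add: F_def t resultant_fiber_def)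
    qed
    have G: "G t \<in> S \<and> F (G t) = t" if "t \<in> {(A, B) \<in> resultant_fiber n x. degree B = k}" for t
    proof -
      from that obtain A B where t: "t = (A, B)" and A: "A \<in> monics n" and B: "degree B = k"
        and res: "resultant A B = x"
        by (auto simp: resultant_fiber_def)
      define b where "b = lead_coeff B"
      define C where "C = smult (inverse b) B"
      have b: "b \<noteq> 0" using B k by (auto simp: b_def)
      have C: "C \<in> monics k" using b B by (simp add: C_def monics_def b_def)
      then have C0: "C \<noteq> 0" by (auto simp: monics_def)
      have BC: "B = smult b C" using b by (simp add: C_def)
      have Q: "A div C \<in> monics (n - k)" using div_in_monics[OF A C] k by simp
      have R: "degree (A mod C) < k"
        using degree_mod_less[OF C0, of A] C k by (auto simp: monics_def)
      have "x = b ^ n * (- 1) ^ (n * k) * resultant C (A mod C)"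
        using resultant_euclid_step[OF Q C R _ b] k by (simp add: res flip: BC)
      then have "resultant C (A mod C) = x * (- 1) ^ (n * k) / b ^ n"
        using b by simp
      moreover have "G t = (b, A div C, C, A mod C)"
        by (simp add: G_def t b_def C_def Let_def)
      ultimately show ?thesis using b Q C R t BC by (simp add: S_def F_def resultant_fiber_def)
    qed
    show "G \<in> {(A, B) \<in> resultant_fiber n x. degree B = k} \<rightarrow> S" using G by blast
    show "F (G t) = t" if "t \<in> {(A, B) \<in> resultant_fiber n x. degree B = k}" for t
      using G[OF that] by blast
    show "G (F t) = t" if "t \<in> S" for t
    proof -
      from that obtain b Q C R where t: "t = (b, Q, C, R)" and b: "b \<noteq> 0"
        and C: "C \<in> monics k" and R: "degree R < k"
        by (auto simp: S_def resultant_fiber_def)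
      have "C \<noteq> 0" "degree R < degree C" using C R k by (auto simp: monics_def)
      moreover have "lead_coeff (smult b C) = b" using C b by (auto simp: monics_def)
      ultimately show ?thesis
        using b by (simp add: t F_def G_def Let_def div_poly_less mod_poly_less)
    qed
  qed
  then have "card {(A, B) \<in> resultant_fiber n x. degree B = k} = card S"
    by (rule bij_betw_same_card[symmetric])
  also have "int (card S) = (\<Sum>b\<in>- {0}. int CARD('a) ^ (n - k)
      * int (card (resultant_fiber k (x * (- 1) ^ (n * k) / b ^ n))))"
    by (simp add: S_def card_cartesian_product card_monics finite_monics finite_resultant_fiber)
  finally show ?thesis by (simp add: sum_distrib_left)
qed

lemma resultant_fiber_recurrence:
  fixes x :: "'a::{field, finite}"
  assumes "n > 0"
  shows "int (card (resultant_fiber n x)) = int CARD('a) ^ n * root_count n x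
    + (\<Sum>k\<in>{0<..<n}. int CARD('a) ^ (n - k)
        * (\<Sum>b\<in>- {0}. int (card (resultant_fiber k (x * (- 1) ^ (n * k) / b ^ n)))))"
proof -
  let ?P = "\<lambda>k. {(A, B) \<in> resultant_fiber n x. degree B = k}"
  have "resultant_fiber n x = (\<Union>k<n. ?P k)" by (auto simp: resultant_fiber_def)
  also have "card \<dots> = (\<Sum>k<n. card (?P k))"
    by (rule card_UN_disjoint)
       (auto intro: finite_subset[OF _ finite_resultant_fiber[of n x]])
  finally have "int (card (resultant_fiber n x)) = (\<Sum>k<n. int (card (?P k)))" by simp
  also have "{..<n} = insert 0 {0<..<n}" using assms by auto
  also have "(\<Sum>k\<in>insert 0 {0<..<n}. int (card (?P k)))
      = int (card (?P 0)) + (\<Sum>k\<in>{0<..<n}. int (card (?P k)))" by simp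
  finally show ?thesis
    using assms by (simp add: card_resultant_fiber_degree_0 card_resultant_fiber_degree)
qed

lemma geometric_sum_over_multiples:
  fixes q :: int
  assumes "m dvd n" "n > 0"
  shows "(q - 1) * (\<Sum>k | k \<in> {0<..<n} \<and> m dvd k. q ^ (k div m - 1)) = q ^ (n div m - 1) - 1"
proof -
  obtain N where N: "n = m * N" using assms by auto
  then have pos: "m > 0" "N > 0" using assms by auto
  have "(\<Sum>k | k \<in> {0<..<n} \<and> m dvd k. q ^ (k div m - 1)) = (\<Sum>t<N - 1. q ^ t)"
  proof (rule sum.reindex_bij_witness[of _ "\<lambda>t. m * Suc t" "\<lambda>k. k div m - 1"], goal_cases)
    case (1 k)
    then show ?case using pos by (auto elim!: dvdE simp del: mult_Suc_right)
  next
    case (2 k)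
    then show ?case using pos by (auto elim!: dvdE simp: N)
  next
    case (3 t)
    then show ?case using pos by simp
  next
    case (4 t)
    then have "m * Suc t < m * N" using pos by (intro mult_strict_left_mono) auto
    then show ?case using pos by (simp add: N)
  qed simp
  then show ?thesis using pos by (simp add: N power_diff_1_eq[symmetric])
qed

text \<open>The recurrence is diagonal in the characters. The component of order \<open>m\<close> receives contributions
only from the degrees \<open>k\<close> that are multiples of \<open>m\<close>, and the resulting geometric sum adds up to
\<open>q ^ (n / m - 1)\<close>.\<close>

theorem card_resultant_fiber:
  fixes x :: "'a::{field, finite}"
  assumes "n > 0" "x \<noteq> 0"
  shows "int (card (resultant_fiber n x))
    = (\<Sum>m | m dvd n. int CARD('a) ^ (n + n div m - 1) * primitive_character_sum m x)"
  using assms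
proof (induction n arbitrary: x rule: less_induct)
  case (less n)
  let ?q = "int CARD('a)" and ?E = "\<lambda>m. primitive_character_sum m x"
  have q: "int (CARD('a) - 1) = ?q - 1" by (simp add: of_nat_diff Suc_leI)
  have pos: "d > 0" if "d dvd n" for d using that less.prems by (auto intro: Nat.gr0I)
  have step: "?q ^ (n - k) * (\<Sum>b\<in>- {0}. int (card (resultant_fiber k (x * (- 1) ^ (n * k) / b ^ n))))
      = (\<Sum>m | m dvd n. ?q ^ n * ?E m * (?q - 1) * (if m dvd k then ?q ^ (k div m - 1) else 0))"
    if k: "k \<in> {0<..<n}" for k
  proof -
    have E: "(\<Sum>b\<in>- {0}. primitive_character_sum m (x * (- 1) ^ (n * k) / b ^ n))
        = (if m dvd n then (?q - 1) * ?E m else 0)" if mk: "m dvd k" for m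
    proof -
      obtain j where j: "k = m * j" using mk by auto
      \<comment> \<open>the sign from exchanging the arguments is an \<open>m\<close>-th power, so the component of order \<open>m\<close> ignores it\<close>
      have "(- 1 :: 'a) ^ (n * k) = ((- 1) ^ (n * j)) ^ m"
        unfolding j power_mult[symmetric] by (simp add: mult_ac)
      then have "primitive_character_sum m (x * (- 1) ^ (n * k)) = ?E m"
        using primitive_character_sum_mult_power[of "(- 1 :: 'a) ^ (n * j)" m x] by (simp only:) simp
      then show ?thesis
        using primitive_character_sum_twisted_sum[of n m "x * (- 1) ^ (n * k)"] less.prems j k
        by (simp add: q)
    qed
    have "(\<Sum>b\<in>- {0}. int (card (resultant_fiber k (x * (- 1) ^ (n * k) / b ^ n))))
        = (\<Sum>b\<in>- {0}. \<Sum>m | m dvd k. ?q ^ (k + k div m - 1)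
            * primitive_character_sum m (x * (- 1) ^ (n * k) / b ^ n))"
      using k less.prems by (intro sum.cong refl less.IH) auto
    also have "\<dots> = (\<Sum>m | m dvd k. ?q ^ (k + k div m - 1) * (if m dvd n then (?q - 1) * ?E m else 0))"
      by (subst sum.swap) (simp add: E flip: sum_distrib_left)
    finally have "?q ^ (n - k) * (\<Sum>b\<in>- {0}. int (card (resultant_fiber k (x * (- 1) ^ (n * k) / b ^ n))))
        = ?q ^ (n - k) * (\<Sum>m | m dvd k. ?q ^ (k + k div m - 1) * (if m dvd n then (?q - 1) * ?E m else 0))"
      by (rule arg_cong)
    also have "\<dots> = (\<Sum>m | m dvd k \<and> m dvd n. ?q ^ n * ?E m * (?q - 1) * ?q ^ (k div m - 1))"
      unfolding sum_distrib_left
    proof (rule sum.mono_neutral_cong_right)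
      fix m assume "m \<in> {m. m dvd k \<and> m dvd n}"
      then have m: "m dvd k" "m dvd n" by auto
      then have "k div m > 0" using k by (auto simp: div_greater_zero_iff dvd_imp_le pos)
      then have "n - k + (k + k div m - 1) = n + (k div m - 1)" using k by auto
      then have "?q ^ (n - k) * ?q ^ (k + k div m - 1) = ?q ^ n * ?q ^ (k div m - 1)"
        by (simp only: power_add[symmetric])
      then show "?q ^ (n - k) * (?q ^ (k + k div m - 1) * (if m dvd n then (?q - 1) * ?E m else 0))
          = ?q ^ n * ?E m * (?q - 1) * ?q ^ (k div m - 1)"
        using m by (simp add: mult_ac)
    qed (use k in auto)
    also have "\<dots> = (\<Sum>m | m dvd n. ?q ^ n * ?E m * (?q - 1) * (if m dvd k then ?q ^ (k div m - 1) else 0))"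
      using less.prems by (intro sum.mono_neutral_cong_left) auto
    finally show ?thesis .
  qed
  have "(\<Sum>k\<in>{0<..<n}. ?q ^ (n - k)
        * (\<Sum>b\<in>- {0}. int (card (resultant_fiber k (x * (- 1) ^ (n * k) / b ^ n)))))
      = (\<Sum>m | m dvd n. \<Sum>k\<in>{0<..<n}.
          ?q ^ n * ?E m * (?q - 1) * (if m dvd k then ?q ^ (k div m - 1) else 0))"
    by (subst sum.swap) (intro sum.cong refl step)
  also have "\<dots> = (\<Sum>m | m dvd n. ?q ^ n * ?E m * (?q ^ (n div m - 1) - 1))"
  proof (intro sum.cong refl)
    fix m assume "m \<in> {m. m dvd n}"
    then have m: "m dvd n" by simp
    have "(\<Sum>k\<in>{0<..<n}. ?q ^ n * ?E m * (?q - 1) * (if m dvd k then ?q ^ (k div m - 1) else 0))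
        = ?q ^ n * ?E m * ((?q - 1) * (\<Sum>k\<in>{0<..<n}. if m dvd k then ?q ^ (k div m - 1) else 0))"
      by (simp only: sum_distrib_left mult.assoc)
    also have "(\<Sum>k\<in>{0<..<n}. if m dvd k then ?q ^ (k div m - 1) else 0)
        = (\<Sum>k | k \<in> {0<..<n} \<and> m dvd k. ?q ^ (k div m - 1))"
      by (intro sum.mono_neutral_cong_right) auto
    finally show "(\<Sum>k\<in>{0<..<n}. ?q ^ n * ?E m * (?q - 1) * (if m dvd k then ?q ^ (k div m - 1) else 0))
        = ?q ^ n * ?E m * (?q ^ (n div m - 1) - 1)"
      using geometric_sum_over_multiples[OF m, of ?q] less.prems by simp
  qed
  finally have "int (card (resultant_fiber n x)) = ?q ^ n * (\<Sum>m | m dvd n. ?E m)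
      + (\<Sum>m | m dvd n. ?q ^ n * ?E m * (?q ^ (n div m - 1) - 1))"
    using less.prems by (simp add: resultant_fiber_recurrence sum_primitive_character_sum)
  also have "\<dots> = (\<Sum>m | m dvd n. ?q ^ (n + n div m - 1) * ?E m)"
    unfolding sum_distrib_left sum.distrib[symmetric]
  proof (intro sum.cong refl)
    fix m assume "m \<in> {m. m dvd n}"
    then have m: "m dvd n" by simp
    then have "n div m > 0" using less.prems by (simp add: div_greater_zero_iff dvd_imp_le pos)
    then have "n + n div m - 1 = n + (n div m - 1)" by simp
    then show "?q ^ n * ?E m + ?q ^ n * ?E m * (?q ^ (n div m - 1) - 1) = ?q ^ (n + n div m - 1) * ?E m"
      by (simp add: power_add algebra_simps)
  qed
  finally show ?case .
qed

text \<open>The resultant of \<open>f\<close> and \<open>g\<close> depends only on \<open>g\<close> and on \<open>f\<close> modulo \<open>g\<close>, which is \<open>f - g\<close>.\<close>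

lemma card_resultant_one_pairs:
  assumes "n > 0"
  shows "card (resultant_one_pairs n :: ('a::{field, finite} poly \<times> 'a poly) set)
    = card (resultant_fiber n (1 :: 'a))"
proof -
  have "bij_betw (\<lambda>(f, g). (g, f - g)) (resultant_one_pairs n) (resultant_fiber n (1 :: 'a))"
  proof (rule bij_betwI[where g = "\<lambda>(A, B). (A + B, A)"])
    have red: "monic_resultant n f g = resultant g (f - g)"
      if "f \<in> monics n" "g \<in> monics n" "degree (f - g) < n" for f g :: "'a poly"
      using that resultant_monic_reduce[of g "f - g" f 1]
      by (auto simp: monics_def monic_resultant_eq_resultant)
    have deg: "degree (f - g) < n" if "f \<in> monics n" "g \<in> monics n" for f g :: "'a poly"
    proof -
      have "degree (f - g) \<le> n" "coeff (f - g) n = 0"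
        using that degree_diff_le[of f n g] by (auto simp: monics_def)
      then show ?thesis using eq_zero_or_degree_less[of "f - g" n] assms by auto
    qed
    show "(\<lambda>(f, g). (g, f - g)) \<in> resultant_one_pairs n \<rightarrow> resultant_fiber n (1 :: 'a)"
      using red deg by (auto simp: resultant_one_pairs_def resultant_fiber_def monics_def)
    show "(\<lambda>(A, B). (A + B, A)) \<in> resultant_fiber n (1 :: 'a) \<rightarrow> resultant_one_pairs n"
    proof
      fix t :: "'a poly \<times> 'a poly" assume "t \<in> resultant_fiber n 1"
      then obtain A B where t: "t = (A, B)" and A: "A \<in> monics n" and B: "degree B < n"
        and res: "resultant A B = 1" by (auto simp: resultant_fiber_def)
      have AB: "A + B \<in> monics n" by (rule monic_add_in_monics[OF A B])
      have "monic_resultant n (A + B) A = 1" using red[OF AB A] B res by simp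
      then show "(\<lambda>(A, B). (A + B, A)) t \<in> resultant_one_pairs n"
        using AB A by (auto simp: t resultant_one_pairs_def monics_def)
    qed
  qed auto
  then show ?thesis by (rule bij_betw_same_card)
qed

theorem theoremA5:
  fixes n q :: nat
  assumes "n > 0"
    and "primepow q"
    and "card (UNIV :: 'a::{field, finite} set) = q"
  shows "int (card (resultant_one_pairs n :: ('a poly \<times> 'a poly) set)) =
    int q ^ n * (\<Sum>(a, b, c) \<in> {(a, b, c). a > 0 \<and> b > 0 \<and> c > 0 \<and> a * b * c = n}.
      moebius_mu a * int q ^ (b - 1) * int (gcd c (q - 1)))"
proof -
  have pos: "m > 0" if "m dvd n" for m using that assms(1) by (auto intro: Nat.gr0I)
  have "int (card (resultant_one_pairs n :: ('a poly \<times> 'a poly) set))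
      = (\<Sum>m | m dvd n. int q ^ (n + n div m - 1) * primitive_character_sum m (1 :: 'a))"
    using assms card_resultant_fiber[of n "1 :: 'a"] by (simp add: card_resultant_one_pairs)
  also have "\<dots> = (\<Sum>m | m dvd n. \<Sum>d | d dvd m.
      int q ^ n * (moebius_mu (m div d) * int q ^ (n div m - 1) * int (gcd d (q - 1))))"
  proof (intro sum.cong refl)
    fix m assume "m \<in> {m. m dvd n}"
    then have m: "m dvd n" by simp
    then have "n div m > 0" using assms(1) by (simp add: div_greater_zero_iff dvd_imp_le pos)
    then have "int q ^ (n + n div m - 1) = int q ^ n * int q ^ (n div m - 1)"
      by (simp flip: power_add)
    moreover have "root_count d (1 :: 'a) = int (gcd d (q - 1))" if "d dvd m" for d
      using that m assms pos[of d] dvd_trans[of d m n]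
      by (simp add: root_count_def card_roots_of_unity)
    ultimately show "int q ^ (n + n div m - 1) * primitive_character_sum m (1 :: 'a)
      = (\<Sum>d | d dvd m. int q ^ n * (moebius_mu (m div d) * int q ^ (n div m - 1) * int (gcd d (q - 1))))"
      by (simp add: primitive_character_sum_def sum_distrib_left mult_ac)
  qed
  also have "\<dots> = (\<Sum>(m, d) \<in> (SIGMA m:{m. m dvd n}. {d. d dvd m}).
      int q ^ n * (moebius_mu (m div d) * int q ^ (n div m - 1) * int (gcd d (q - 1))))"
    using assms(1) pos by (subst sum.Sigma) auto
  \<comment> \<open>a chain of divisors \<open>d dvd m dvd n\<close> is a factorization of \<open>n\<close> into \<open>a = m / d\<close>, \<open>b = n / m\<close> and \<open>c = d\<close>\<close>
  also have "\<dots> = (\<Sum>(a, b, c) \<in> {(a, b, c). a > 0 \<and> b > 0 \<and> c > 0 \<and> a * b * c = n}.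
      int q ^ n * (moebius_mu a * int q ^ (b - 1) * int (gcd c (q - 1))))"
    using assms(1)
    by (intro sum.reindex_bij_witness[of _ "\<lambda>(a, b, c). (a * c, c)" "\<lambda>(m, d). (m div d, n div m, d)"])
       (auto simp: mult_ac elim!: dvdE)
  also have "\<dots> = int q ^ n * (\<Sum>(a, b, c) \<in> {(a, b, c). a > 0 \<and> b > 0 \<and> c > 0 \<and> a * b * c = n}.
      moebius_mu a * int q ^ (b - 1) * int (gcd c (q - 1)))"
    by (simp add: sum_distrib_left case_prod_unfold)
  finally show ?thesis .
qed

end
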